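(* Let $E=\{n^2:\ n\in\mathbb{N}\}$ and $P=\mathbb{N}\setminus E$. Then $P$ is a $\Delta^*$-set and the spacing shift $(\Sigma_P,\sigma_P)$ has topological entropy $h_{\sigma_P}=0$. (Hence $P$ being a $\Delta^*$-set is not a sufficient condition for $h_{\sigma_P}>0$.)
   Context: $\mathbb{N}=\{1,2,3,\dots\}$. Let $\Sigma=\prod_{i=0}^{\infty}\{0,1\}$ be the one-sided full shift on two symbols with shift map $\sigma$, $(\sigma s)_i=s_{i+1}$. For $P\subseteq\mathbb{N}$ the spacing shift is the subshift $\Sigma_P=\{s\in\Sigma:\ s_i=s_j=1\Rightarrow |i-j|\in P\cup\{0\}\}$, and $\sigma_P$ is the restriction of $\sigma$ to $\Sigma_P$; $h_{\sigma_P}$ is its topological entropy. A set $D\subseteq\mathbb{N}$ is a $\Delta$-set if there is a (strictly) increasing sequence of natural numbers $S=(s_n)_{n\in\mathbb{N}}$ with $\Delta(S)=\{s_i-s_j:\ i>j\}\subseteq D$. A set $G\subseteq\mathbb{N}$ is a $\Delta^*$-set if $G\cap D\neq\emptyset$ for every $\Delta$-set $D$. *)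

theory Defs
  imports "HOL-Analysis.Analysis"
begin

definition pos_nats :: "nat set" where
  "pos_nats = {1..}"

definition open_cover :: "'a topology \<Rightarrow> 'a set set \<Rightarrow> bool" where
  "open_cover X \<U> \<longleftrightarrow> (\<forall>U\<in>\<U>. openin X U) \<and> \<Union>\<U> = topspace X"

definition min_subcover :: "'a topology \<Rightarrow> 'a set set \<Rightarrow> nat" where
  "min_subcover X \<U> =
     (LEAST n. \<exists>\<V>\<subseteq>\<U>. finite \<V> \<and> card \<V> = n \<and> \<Union>\<V> = topspace X)"

definition iterated_join ::
    "'a topology \<Rightarrow> ('a \<Rightarrow> 'a) \<Rightarrow> 'a set set \<Rightarrow> nat \<Rightarrow> 'a set set" where
  "iterated_join X f \<U> n =
     {{x \<in> topspace X. \<forall>i<n. (f ^^ i) x \<in> A i} | A. \<forall>i<n. A i \<in> \<U>}"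

text \<open>For a continuous self-map of a compact space the sequence below converges, by
  subadditivity, so the limit superior is the limit of the usual definition
  (Adler, Konheim and McAndrew).\<close>

definition cover_entropy :: "'a topology \<Rightarrow> ('a \<Rightarrow> 'a) \<Rightarrow> 'a set set \<Rightarrow> ereal" where
  "cover_entropy X f \<U> =
     limsup (\<lambda>n. ereal (ln (real (min_subcover X (iterated_join X f \<U> n))) / real n))"

definition topological_entropy :: "'a topology \<Rightarrow> ('a \<Rightarrow> 'a) \<Rightarrow> ereal" where
  "topological_entropy X f = (SUP \<U>\<in>{\<U>. open_cover X \<U>}. cover_entropy X f \<U>)"

definition full_shift :: "(nat \<Rightarrow> nat) topology" where
  "full_shift = product_topology (\<lambda>i. discrete_topology {0, 1}) UNIV"

definition shift :: "(nat \<Rightarrow> nat) \<Rightarrow> nat \<Rightarrow> nat" where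
  "shift s = (\<lambda>i. s (Suc i))"

definition spacing_set :: "nat set \<Rightarrow> (nat \<Rightarrow> nat) set" where
  "spacing_set P = {s \<in> topspace full_shift.
     \<forall>i j. s i = 1 \<and> s j = 1 \<longrightarrow> nat \<bar>int i - int j\<bar> \<in> P \<union> {0}}"

definition spacing_shift :: "nat set \<Rightarrow> (nat \<Rightarrow> nat) topology" where
  "spacing_shift P = subtopology full_shift (spacing_set P)"

definition spacing_map :: "nat set \<Rightarrow> (nat \<Rightarrow> nat) \<Rightarrow> nat \<Rightarrow> nat" where
  "spacing_map P = restrict shift (spacing_set P)"

definition spacing_entropy :: "nat set \<Rightarrow> ereal" where
  "spacing_entropy P = topological_entropy (spacing_shift P) (spacing_map P)"

text \<open>Sequences are indexed by the positive integers; the value at \<open>0\<close> is irrelevant.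
  Truncated subtraction is harmless because only increasing sequences are used.\<close>

definition difference_set :: "(nat \<Rightarrow> nat) \<Rightarrow> nat set" where
  "difference_set s = {s i - s j | i j. i \<in> pos_nats \<and> j \<in> pos_nats \<and> i > j}"

definition Delta_set :: "nat set \<Rightarrow> bool" where
  "Delta_set D \<longleftrightarrow> D \<subseteq> pos_nats \<and>
     (\<exists>s. s ` pos_nats \<subseteq> pos_nats \<and> strict_mono_on pos_nats s \<and> difference_set s \<subseteq> D)"

definition Delta_star_set :: "nat set \<Rightarrow> bool" where
  "Delta_star_set G \<longleftrightarrow> G \<subseteq> pos_nats \<and> (\<forall>D. Delta_set D \<longrightarrow> G \<inter> D \<noteq> {})"

end

theory Submission
  imports Defs
begin

text \<open>A sequence whose differences are all squares would give infinitely many solutions of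
  \<open>x\<^sup>2 - y\<^sup>2 = s\<^sub>2 - s\<^sub>1\<close>, so the nonsquares meet every \<open>\<Delta>\<close>-set.

  The supports of words of the spacing shift are sets without square differences. By the
  Furstenberg-Sarkozy theorem they have density \<open>o(1)\<close>, so there are only \<open>exp (o(n))\<close> of them, and a
  Lebesgue number argument bounds the subcovers of the iterated join of any open cover by their number.

  For the Furstenberg-Sarkozy theorem, let \<open>\<delta>\<close> be the limiting maximal density and let \<open>A \<subseteq> {..<N}\<close>
  have density at least \<open>\<delta>\<close>. Square-difference-freeness passes to progressions of step \<open>q\<^sup>2\<close>, so \<open>A\<close>
  has density at most \<open>\<delta> + \<epsilon>\<close> on each of them, hence also on long progressions of any bounded step
  \<open>2d\<close>. Let \<open>W n x\<close> count the \<open>h < H\<close> with \<open>x + (n + h + 1)\<^sup>2 \<in> A\<close>. It vanishes on \<open>A\<close>, but its variance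
  around \<open>\<delta> H\<close>, averaged over \<open>n\<close>, is small: since \<open>(n + h + d)\<^sup>2 - (n + h)\<^sup>2\<close> is linear in \<open>n\<close> with slope
  \<open>2d\<close>, the off-diagonal correlations are controlled by these progressions. So \<open>\<delta> = 0\<close>.\<close>

section \<open>Sets without square differences\<close>

text \<open>The condition met by the set of ones of a point of the spacing shift. Requiring
  \<open>x < y\<close> makes truncated subtraction exact; for \<open>nonsquares\<close> it forbids
  positive square differences.\<close>

definition diff_in :: "nat set \<Rightarrow> nat set \<Rightarrow> bool" where
  "diff_in P A \<longleftrightarrow> (\<forall>x\<in>A. \<forall>y\<in>A. x < y \<longrightarrow> y - x \<in> P)"

abbreviation nonsquares :: "nat set" where
  "nonsquares \<equiv> pos_nats - {n\<^sup>2 | n. n \<in> pos_nats}"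

lemma diff_in_nonsquares_add_square:
  assumes "diff_in nonsquares A" "x \<in> A" "m > 0"
  shows "x + m\<^sup>2 \<notin> A"
proof
  assume "x + m\<^sup>2 \<in> A"
  then have "(x + m\<^sup>2) - x \<in> nonsquares"
    using assms unfolding diff_in_def by (meson less_add_same_cancel1 zero_less_power)
  moreover have "m\<^sup>2 \<in> {n\<^sup>2 | n. n \<in> pos_nats}"
    using assms(3) unfolding pos_nats_def by (intro CollectI exI[of _ m]) simp
  ultimately show False
    by simp
qed

text \<open>Squares are closed under multiplication by \<open>q\<^sup>2\<close>: a difference
  \<open>n\<^sup>2\<close> of two indices becomes the difference \<open>(q * n)\<^sup>2\<close> in
  \<open>A\<close>.\<close>

lemma diff_in_nonsquares_dilate:
  assumes "diff_in nonsquares A" "q > 0"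
  shows "diff_in nonsquares {m. y + q\<^sup>2 * m \<in> A}"
  unfolding diff_in_def
proof (intro ballI impI)
  fix m l assume *: "m \<in> {m. y + q\<^sup>2 * m \<in> A}" "l \<in> {m. y + q\<^sup>2 * m \<in> A}" "m < l"
  have "l - m \<noteq> n\<^sup>2" if "n \<in> pos_nats" for n
  proof
    assume "l - m = n\<^sup>2"
    then have "l = m + n\<^sup>2" using *(3) by linarith
    then have "y + q\<^sup>2 * l = (y + q\<^sup>2 * m) + (q * n)\<^sup>2"
      by (simp add: algebra_simps power_mult_distrib)
    moreover have "q * n > 0" using that assms by (simp add: pos_nats_def)
    ultimately show False
      using diff_in_nonsquares_add_square[OF assms(1)] * by (metis mem_Collect_eq)
  qed
  then show "l - m \<in> nonsquares"
    using *(3) by (auto simp: pos_nats_def)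
qed

section \<open>Counting along progressions and under translation\<close>

lemma sum_lessThan_mult:
  fixes f :: "nat \<Rightarrow> 'a::comm_monoid_add"
  shows "(\<Sum>n<m * k. f n) = (\<Sum>i<m. \<Sum>r<k. f (i * k + r))"
proof -
  have "(\<Sum>n\<in>{i * k..<i * k + k}. f n) = (\<Sum>r<k. f (i * k + r))" for i
    by (subst sum.atLeastLessThan_shift_0) (simp add: atLeast0LessThan comp_def)
  then show ?thesis
    by (simp flip: sum.nat_group)
qed

text \<open>Sorting \<open>n\<close> by its residue modulo \<open>q\<close> splits a progression of
  step \<open>q\<close> into \<open>q\<close> progressions of step \<open>q\<^sup>2\<close>. Each is
  cut into \<open>j\<close> blocks of length \<open>N\<close>, and \<open>A\<close> has no square
  differences along a block, so \<open>R\<close> applies.\<close>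

lemma sum_indicator_progression_le:
  fixes A :: "nat set" and R :: real
  assumes A: "diff_in nonsquares A" and q: "q > 0"
    and R: "\<And>B. B \<subseteq> {..<N} \<Longrightarrow> diff_in nonsquares B \<Longrightarrow> real (card B) \<le> R"
  shows "(\<Sum>n<j * N * q. indicator A (y + q * n)) \<le> real (j * q) * R"
proof -
  have block: "(\<Sum>m<N. indicator A (z + q\<^sup>2 * m)) \<le> R" for z
  proof -
    let ?B = "{m. m < N \<and> z + q\<^sup>2 * m \<in> A}"
    have "?B = {..<N} \<inter> {m. z + q\<^sup>2 * m \<in> A}" by auto
    then have "(\<Sum>m<N. indicator A (z + q\<^sup>2 * m)) = real (card ?B)"
      by (simp add: indicator_def)
    also have "\<dots> \<le> R"
    proof (rule R)
      show "diff_in nonsquares ?B"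
        using diff_in_nonsquares_dilate[OF A q, of z] unfolding diff_in_def by blast
    qed auto
    finally show ?thesis .
  qed
  have "(\<Sum>n<j * N * q. indicator A (y + q * n)) =
        (\<Sum>k<j * N. \<Sum>r<q. indicator A (y + q * (k * q + r)) :: real)"
    by (rule sum_lessThan_mult)
  also have "\<dots> = (\<Sum>r<q. \<Sum>k<j * N. indicator A (y + q * (k * q + r)))"
    by (rule sum.swap)
  also have "\<dots> = (\<Sum>r<q. \<Sum>i<j. \<Sum>m<N. indicator A (y + q * ((i * N + m) * q + r)))"
    by (subst sum_lessThan_mult) (rule refl)
  also have "\<dots> = (\<Sum>r<q. \<Sum>i<j. \<Sum>m<N. indicator A ((y + q * r + q\<^sup>2 * (i * N)) + q\<^sup>2 * m))"
  proof -
    have "y + q * ((i * N + m) * q + r) = (y + q * r + q\<^sup>2 * (i * N)) + q\<^sup>2 * m" for i m r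
      by (simp add: algebra_simps power2_eq_square)
    then show ?thesis by (simp only:)
  qed
  also have "\<dots> \<le> (\<Sum>r<q. \<Sum>i<j. R)"
    by (intro sum_mono block)
  finally show ?thesis by (simp add: mult_ac)
qed

text \<open>The translate by \<open>s\<close> loses only the elements of \<open>A\<close> below
  \<open>s\<close>, at most \<open>s\<close> in number.\<close>

lemma sum_indicator_shift_ge:
  fixes A :: "nat set"
  assumes "A \<subseteq> {..<N}"
  shows "(\<Sum>x<N. indicator A (x + s)) \<ge> real (card A) - real s"
proof -
  have "A \<subseteq> {..<s} \<union> (\<lambda>x. x + s) ` {x. x < N \<and> x + s \<in> A}"
  proof
    fix y assume "y \<in> A"
    show "y \<in> {..<s} \<union> (\<lambda>x. x + s) ` {x. x < N \<and> x + s \<in> A}"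
    proof (cases "y < s")
      case False
      then have "y = (y - s) + s" "y - s < N" using assms \<open>y \<in> A\<close> by auto
      then show ?thesis using \<open>y \<in> A\<close> by (metis (mono_tags, lifting) UnI2 image_eqI mem_Collect_eq)
    qed auto
  qed
  then have "card A \<le> card ({..<s} \<union> (\<lambda>x. x + s) ` {x. x < N \<and> x + s \<in> A})"
    by (intro card_mono) auto
  also have "\<dots> \<le> s + card {x. x < N \<and> x + s \<in> A}"
    by (rule order_trans[OF card_Un_le]) (simp add: card_image_le)
  finally have "card A \<le> s + card {x. x < N \<and> x + s \<in> A}" .
  moreover have "real (card {x. x < N \<and> x + s \<in> A}) = (\<Sum>x<N. indicator A (x + s))"
  proof -
    have "{x. x < N \<and> x + s \<in> A} = {..<N} \<inter> {x. x + s \<in> A}" by auto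
    then show ?thesis by (simp add: indicator_def)
  qed
  ultimately show ?thesis by linarith
qed

text \<open>Substituting \<open>y = x + s\<close> turns the first factor into the restriction to
  \<open>A\<close>.\<close>

lemma sum_indicator_correlation_le:
  fixes A :: "nat set"
  assumes "A \<subseteq> {..<N}"
  shows "(\<Sum>x<N. indicator A (x + s) * indicator A (x + (s + t))) \<le>
         (\<Sum>y\<in>A. indicator A (y + t) :: real)"
proof -
  have fin: "finite A" using assms finite_subset by blast
  have "(\<Sum>x<N. indicator A (x + s) * indicator A (x + (s + t)) :: real) =
        (\<Sum>y\<in>(\<lambda>x. x + s) ` {..<N}. indicator A y * indicator A (y + t))"
    by (subst sum.reindex) (auto simp: inj_on_def algebra_simps)
  also have "\<dots> = (\<Sum>y\<in>(\<lambda>x. x + s) ` {..<N} \<inter> A. indicator A (y + t))"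
    by (intro sum.mono_neutral_cong_right) (auto simp: indicator_def)
  also have "\<dots> \<le> (\<Sum>y\<in>A. indicator A (y + t))"
    by (intro sum_mono2 fin) auto
  finally show ?thesis .
qed

section \<open>The variance estimate and the density theorem\<close>

text \<open>Here \<open>1 / H\<close> comes from the diagonal of the second moment, and the last
  term pays for translating \<open>A\<close> by up to \<open>(M + H)\<^sup>2\<close>. For \<delta> >
  0 this is impossible once \<beta> is close to \<delta>, \<open>H\<close> is large and
  \<open>card A\<close> dominates \<open>(M + H)\<^sup>2\<close>.\<close>

lemma square_difference_free_density_le:
  fixes A :: "nat set" and \<delta> \<beta> :: real
  assumes A: "diff_in nonsquares A" "A \<subseteq> {..<N}"
    and \<delta>: "0 \<le> \<delta>" "\<delta> * N \<le> card A" and "H > 0" "M > 0"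
    and \<beta>: "\<And>d y. 0 < d \<Longrightarrow> d < H \<Longrightarrow> (\<Sum>n<M. indicator A (y + 2 * d * n)) \<le> \<beta> * M"
      and "\<beta> \<ge> 0"
  shows "\<delta>\<^sup>2 * card A \<le> card A * (\<beta> - \<delta> + 1 / H) + 2 * \<delta> * (real (M + H))\<^sup>2"
proof -
  define a :: "nat \<Rightarrow> real" where "a = indicator A"
  define W where "W n x = (\<Sum>h<H. a (x + (n + h + 1)\<^sup>2))" for n x
  define c where "c = real (card A)"
  have c0: "c \<ge> 0" by (simp add: c_def)
  have W0: "W n x = 0" if "x \<in> A" for n x
    unfolding W_def a_def
    using diff_in_nonsquares_add_square[OF A(1) that] by (intro sum.neutral) (auto simp: indicator_def)
  have lower: "(\<delta> * H)\<^sup>2 * c \<le> (\<Sum>x<N. (W n x - \<delta> * H)\<^sup>2)" for n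
  proof -
    have "(\<delta> * H)\<^sup>2 * c = (\<Sum>x\<in>A. (W n x - \<delta> * H)\<^sup>2)"
      by (simp add: W0 c_def)
    also have "\<dots> \<le> (\<Sum>x<N. (W n x - \<delta> * H)\<^sup>2)"
      using A(2) by (intro sum_mono2) auto
    finally show ?thesis .
  qed
  have linear: "(\<Sum>x<N. W n x) \<ge> H * (c - (real (M + H))\<^sup>2)" if "n < M" for n
  proof -
    have "(\<Sum>x<N. W n x) = (\<Sum>h<H. \<Sum>x<N. a (x + (n + h + 1)\<^sup>2))"
      unfolding W_def by (rule sum.swap)
    also have "\<dots> \<ge> (\<Sum>h<H. c - (real (M + H))\<^sup>2)"
    proof (rule sum_mono)
      fix h assume "h \<in> {..<H}"
      then have "real ((n + h + 1)\<^sup>2) \<le> real ((M + H)\<^sup>2)"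
        using that by (intro of_nat_mono power_mono) auto
      then show "c - (real (M + H))\<^sup>2 \<le> (\<Sum>x<N. a (x + (n + h + 1)\<^sup>2))"
        using sum_indicator_shift_ge[OF A(2), of "(n + h + 1)\<^sup>2"] unfolding a_def c_def of_nat_power
        by linarith
    qed
    finally show ?thesis by simp
  qed
  define T where "T h k = (\<Sum>n<M. \<Sum>x<N. a (x + (n + h + 1)\<^sup>2) * a (x + (n + k + 1)\<^sup>2))" for h k
  have T_sym: "T h k = T k h" for h k
    unfolding T_def by (simp add: mult.commute)
  have T_diag: "T h h \<le> M * c" for h
  proof -
    have "(\<Sum>x<N. a (x + s) * a (x + s)) \<le> c" for s
      using sum_indicator_correlation_le[OF A(2), of s 0] by (simp add: a_def c_def)
    then have "T h h \<le> (\<Sum>n<M. c)"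
      unfolding T_def by (intro sum_mono)
    then show ?thesis by simp
  qed
  have T_less: "T h k \<le> c * (\<beta> * M)" if "h < k" "k < H" for h k
  proof -
    define d where "d = k - h"
    have k: "k = h + d" "0 < d" "d < H" using that by (auto simp: d_def)
    \<comment> \<open>The part of the gap between the two squares that is independent of
      \<open>n\<close>; for fixed \<open>y\<close> in \<open>A\<close>, the sum over
      \<open>n\<close> then runs along a progression of step \<open>2 * d\<close>.\<close>
    define e where "e = d * (2 * h + d + 2)"
    have sq: "(n + k + 1)\<^sup>2 = (n + h + 1)\<^sup>2 + (e + 2 * d * n)" for n
      by (simp add: k e_def power2_eq_square algebra_simps)
    have "T h k \<le> (\<Sum>n<M. \<Sum>y\<in>A. a (y + (e + 2 * d * n)))"
      unfolding T_def sq a_def by (intro sum_mono sum_indicator_correlation_le A)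
    also have "\<dots> = (\<Sum>y\<in>A. \<Sum>n<M. a ((y + e) + 2 * d * n))"
      by (subst sum.swap) (simp add: algebra_simps)
    also have "\<dots> \<le> (\<Sum>y\<in>A. \<beta> * M)"
      unfolding a_def by (intro sum_mono \<beta> k)
    finally show ?thesis by (simp add: c_def)
  qed
  \<comment> \<open>As \<beta> is nonnegative, the off-diagonal bound may be added on the diagonal
    too, which makes the double sum uniform.\<close>
  have T_le: "T h k \<le> c * (\<beta> * M) + (if h = k then M * c else 0)" if "h < H" "k < H" for h k
    using T_less[of h k] T_less[of k h] T_diag[of h] T_sym[of h k] that c0 \<open>\<beta> \<ge> 0\<close>
    by (cases h k rule: linorder_cases) (auto simp: add_increasing)
  have "(\<Sum>n<M. \<Sum>x<N. (W n x)\<^sup>2) = (\<Sum>n<M. \<Sum>x<N. \<Sum>h<H. \<Sum>k<H.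
      a (x + (n + h + 1)\<^sup>2) * a (x + (n + k + 1)\<^sup>2))"
    by (simp add: W_def power2_eq_square sum_product)
  \<comment> \<open>Fixing both index sets orients \<open>sum.swap\<close>: it can only move the sum
    over \<open>x\<close> inwards, so rewriting terminates.\<close>
  also have "\<dots> = (\<Sum>n<M. \<Sum>h<H. \<Sum>k<H. \<Sum>x<N. a (x + (n + h + 1)\<^sup>2) * a (x + (n + k + 1)\<^sup>2))"
    by (simp only: sum.swap[of _ "{..<H}" "{..<N}"])
  also have "\<dots> = (\<Sum>h<H. \<Sum>k<H. T h k)"
    unfolding T_def by (simp only: sum.swap[of _ "{..<H}" "{..<M}"])
  also have "\<dots> \<le> (\<Sum>h<H. \<Sum>k<H. c * (\<beta> * M) + (if h = k then M * c else 0))"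
    by (intro sum_mono T_le) auto
  also have "\<dots> = M * H * c + (real H)\<^sup>2 * \<beta> * M * c"
    by (simp add: sum.distrib power2_eq_square algebra_simps)
  finally have quadratic: "(\<Sum>n<M. \<Sum>x<N. (W n x)\<^sup>2) \<le> M * H * c + (real H)\<^sup>2 * \<beta> * M * c" .
  have "M * ((\<delta> * H)\<^sup>2 * c) = (\<Sum>n<M. (\<delta> * H)\<^sup>2 * c)" by simp
  also have "\<dots> \<le> (\<Sum>n<M. \<Sum>x<N. (W n x - \<delta> * H)\<^sup>2)"
    by (intro sum_mono lower)
  also have "\<dots> = (\<Sum>n<M. \<Sum>x<N. (W n x)\<^sup>2) - 2 * \<delta> * H * (\<Sum>n<M. \<Sum>x<N. W n x) + M * N * (\<delta> * H)\<^sup>2"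
    by (simp add: power2_diff sum.distrib sum_subtractf sum_distrib_left algebra_simps)
  \<comment> \<open>The lower bound on the density enters through the constant term, where
    \<open>\<delta> * N\<close> is replaced by \<open>c\<close>. Together with the linear term this
    leaves \<open>\<beta> - 2 * \<delta> + \<delta>\<close>.\<close>
  also have "\<dots> \<le> (M * H * c + (real H)\<^sup>2 * \<beta> * M * c) - 2 * \<delta> * H * (\<Sum>n<M. H * (c - (real (M + H))\<^sup>2))
      + M * H\<^sup>2 * \<delta> * c"
  proof -
    have "\<delta> * N * (M * H\<^sup>2 * \<delta>) \<le> c * (M * H\<^sup>2 * \<delta>)"
      using \<delta> by (intro mult_right_mono) (auto simp: c_def)
    then have "M * N * (\<delta> * H)\<^sup>2 \<le> M * H\<^sup>2 * \<delta> * c"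
      by (simp add: power2_eq_square mult_ac)
    moreover have "2 * \<delta> * H * (\<Sum>n<M. H * (c - (real (M + H))\<^sup>2)) \<le> 2 * \<delta> * H * (\<Sum>n<M. \<Sum>x<N. W n x)"
      using \<delta>(1) linear by (intro mult_left_mono sum_mono) auto
    ultimately show ?thesis using quadratic by linarith
  qed
  also have "\<dots> = M * (real H)\<^sup>2 * (c * (\<beta> - \<delta> + 1 / H) + 2 * \<delta> * (real (M + H))\<^sup>2)"
    using \<open>H > 0\<close> by (simp add: field_simps power2_eq_square)
  finally have "M * (real H)\<^sup>2 * (\<delta>\<^sup>2 * c) \<le> M * (real H)\<^sup>2 * (c * (\<beta> - \<delta> + 1 / H) + 2 * \<delta> * (real (M + H))\<^sup>2)"
    by (simp add: power_mult_distrib mult_ac)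
  then show ?thesis
    using \<open>H > 0\<close> \<open>M > 0\<close> by (simp add: c_def)
qed

theorem furstenberg_sarkozy:
  fixes \<epsilon> :: real
  assumes "\<epsilon> > 0"
  shows "\<exists>N>0. \<forall>A\<subseteq>{..<N}. diff_in nonsquares A \<longrightarrow> card A \<le> \<epsilon> * N"
proof -
  define F where "F N = {A. A \<subseteq> {..<N} \<and> diff_in nonsquares A}" for N
  define r where "r N = Max (card ` F N)" for N
  have finF: "finite (F N)" for N
    unfolding F_def by (rule finite_subset[of _ "Pow {..<N}"]) auto
  have neF: "F N \<noteq> {}" for N
    unfolding F_def diff_in_def by blast
  have r_ge: "card A \<le> r N" if "A \<in> F N" for A N
    unfolding r_def using that finF by (intro Max_ge) auto
  have r_ex: "\<exists>A\<in>F N. card A = r N" for N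
    using Max_in[of "card ` F N"] finF neF unfolding r_def by (metis finite_imageI image_iff image_is_empty)
  \<comment> \<open>The infimum provides both facts used below: \<open>r N\<close> is at least
    \<open>\<delta> * N\<close> at every length and almost equal to it at some length.\<close>
  define \<delta> where "\<delta> = (INF N\<in>{0<..}. r N / real N)"
  have bdd: "bdd_below ((\<lambda>N. r N / real N) ` {0<..})"
    by (rule bdd_belowI[of _ 0]) auto
  have \<delta>0: "\<delta> \<ge> 0" unfolding \<delta>_def by (intro cINF_greatest) auto
  have \<delta>_le: "\<delta> * N \<le> r N" for N
  proof (cases "N = 0")
    case False
    then have "\<delta> \<le> r N / N" unfolding \<delta>_def by (intro cINF_lower bdd) auto
    then show ?thesis using False by (simp add: field_simps)
  qed simp
  have approx: "\<exists>N>0. r N \<le> (\<delta> + e) * N" if "e > 0" for e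
  proof -
    have "\<exists>N\<in>{0<..}. r N / real N < \<delta> + e"
      using that by (subst cINF_less_iff[symmetric]) (auto simp: bdd \<delta>_def)
    then show ?thesis by (force simp: field_simps)
  qed
  have "\<delta> = 0"
  proof (rule ccontr)
    assume "\<delta> \<noteq> 0"
    then have pos: "\<delta> > 0" using \<delta>0 by simp
    \<comment> \<open>\<open>1 / H\<close> and the excess density at length \<open>K\<close> each
      cost at most a quarter of \<open>\<delta>\<^sup>2\<close>. The last choice, \<open>N\<close>,
      makes the translation error smaller than the remaining half.\<close>
    obtain H0 where "inverse (real (Suc H0)) < \<delta>\<^sup>2 / 4"
      using reals_Archimedean[of "\<delta>\<^sup>2 / 4"] pos by auto
    then obtain H where H: "H > 0" "1 / real H \<le> \<delta>\<^sup>2 / 4"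
      by (metis inverse_eq_divide less_imp_le zero_less_Suc)
    obtain K where K: "K > 0" "r K \<le> (\<delta> + \<delta>\<^sup>2 / 4) * K"
      using approx[of "\<delta>\<^sup>2 / 4"] pos by auto
    \<comment> \<open>every step \<open>2 * d\<close> with \<open>d < H\<close> must divide \<open>M div K\<close>\<close>
    define M where "M = K * fact (2 * H)"
    have M: "M > 0" using K by (simp add: M_def)
    obtain N where N: "real N > 4 * (real (M + H))\<^sup>2 / \<delta>\<^sup>2"
      using reals_Archimedean2 by blast
    obtain A where A: "A \<in> F N" "card A = r N" using r_ex by blast
    then have A': "A \<subseteq> {..<N}" "diff_in nonsquares A" by (auto simp: F_def)
    have "(\<Sum>n<M. indicator A (y + 2 * d * n)) \<le> (\<delta> + \<delta>\<^sup>2 / 4) * M" if d: "0 < d" "d < H" for d y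
    proof -
      have "2 * d dvd (fact (2 * H) :: nat)" using d by (intro dvd_fact) auto
      then obtain j where j: "(fact (2 * H) :: nat) = 2 * d * j" by auto
      have M_eq: "M = j * K * (2 * d)" unfolding M_def j by (simp add: mult_ac)
      then have "(\<Sum>n<M. indicator A (y + 2 * d * n)) \<le> real (j * (2 * d)) * real (r K)"
        using sum_indicator_progression_le[OF A'(2), of "2 * d" K "real (r K)" y j] d r_ge
        by (auto simp: F_def)
      also have "\<dots> \<le> real (j * (2 * d)) * ((\<delta> + \<delta>\<^sup>2 / 4) * K)"
        using K by (intro mult_left_mono) auto
      also have "\<dots> = (\<delta> + \<delta>\<^sup>2 / 4) * M"
        using M_eq by simp
      finally show ?thesis .
    qed
    from square_difference_free_density_le[OF A'(2,1) \<delta>0 _ H(1) M this] \<delta>_le[of N] A pos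
    have "\<delta>\<^sup>2 * r N \<le> r N * (\<delta>\<^sup>2 / 4 + 1 / H) + 2 * \<delta> * (real (M + H))\<^sup>2"
      by simp
    also have "\<dots> \<le> r N * (\<delta>\<^sup>2 / 4 + \<delta>\<^sup>2 / 4) + 2 * \<delta> * (real (M + H))\<^sup>2"
      using H pos by (intro add_mono mult_left_mono) auto
    finally have "\<delta>\<^sup>2 * r N \<le> 4 * \<delta> * (real (M + H))\<^sup>2" by (simp add: algebra_simps)
    moreover have "\<delta>\<^sup>2 * (\<delta> * N) \<le> \<delta>\<^sup>2 * r N" using \<delta>_le by (intro mult_left_mono) auto
    moreover have "4 * \<delta> * (real (M + H))\<^sup>2 < \<delta>\<^sup>2 * (\<delta> * N)"
      using mult_strict_left_mono[OF N, of "\<delta>^3"] pos by (simp add: power2_eq_square power3_eq_cube)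
    ultimately show False by linarith
  qed
  then obtain N where "N > 0" "real (r N) \<le> \<epsilon> * N"
    using approx[OF assms] by auto
  moreover have "real (card A) \<le> r N" if "A \<subseteq> {..<N}" "diff_in nonsquares A" for A
    using r_ge that by (simp add: F_def)
  ultimately show ?thesis
    by (meson order_trans)
qed

section \<open>Words and entropy of spacing shifts\<close>

lemma topspace_full_shift: "topspace full_shift = {s. \<forall>i. s i = 0 \<or> s i = 1}"
  by (auto simp: full_shift_def PiE_def Pi_def)

lemma spacing_set_subset: "spacing_set P \<subseteq> topspace full_shift"
  by (auto simp: spacing_set_def)

lemma topspace_spacing_shift: "topspace (spacing_shift P) = spacing_set P"
  using spacing_set_subset by (auto simp: spacing_shift_def)

lemma shift_in_spacing_set: "x \<in> spacing_set P \<Longrightarrow> shift x \<in> spacing_set P"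
  unfolding spacing_set_def topspace_full_shift shift_def by force

lemma shift_funpow: "(shift ^^ i) x = (\<lambda>j. x (i + j))"
  by (induction i) (auto simp: shift_def)

text \<open>Outside \<open>spacing_set P\<close> the restricted map is \<open>undefined\<close>, so
  the induction must carry invariance along.\<close>

lemma spacing_map_funpow:
  assumes "x \<in> spacing_set P"
  shows "(spacing_map P ^^ i) x = (\<lambda>j. x (i + j))" "(\<lambda>j. x (i + j)) \<in> spacing_set P"
proof -
  have "(spacing_map P ^^ i) x = (shift ^^ i) x \<and> (shift ^^ i) x \<in> spacing_set P"
    using assms by (induction i) (auto simp: spacing_map_def shift_in_spacing_set)
  then show "(spacing_map P ^^ i) x = (\<lambda>j. x (i + j))" "(\<lambda>j. x (i + j)) \<in> spacing_set P"
    by (simp_all add: shift_funpow)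
qed

text \<open>The complement is a union, over forbidden pairs of positions, of open sets with ones at
  both; the full shift is compact by Tychonoff.\<close>

lemma compactin_spacing_set: "compactin full_shift (spacing_set P)"
proof -
  have proj: "continuous_map full_shift (discrete_topology {0, 1}) (\<lambda>s. s i)" for i :: nat
    unfolding full_shift_def by (rule continuous_map_product_projection) simp
  have ones: "openin full_shift {s \<in> topspace full_shift. s i = 1}" for i
    using openin_continuous_map_preimage[OF proj, of "{1}" i] by simp
  have "topspace full_shift - spacing_set P =
      (\<Union>(i, j)\<in>{(i, j). nat \<bar>int i - int j\<bar> \<notin> P \<union> {0}}.
        {s \<in> topspace full_shift. s i = 1} \<inter> {s \<in> topspace full_shift. s j = 1})"
    unfolding spacing_set_def by auto
  also have "openin full_shift \<dots>"
    using ones by (intro openin_Union) auto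
  finally have "closedin full_shift (spacing_set P)"
    unfolding closedin_def using spacing_set_subset by auto
  moreover have "compact_space full_shift"
    unfolding full_shift_def by (simp add: compact_space_product_topology compact_space_discrete_topology)
  ultimately show ?thesis
    by (simp add: closedin_compact_space)
qed

lemma openin_cylinder:
  "openin full_shift {y \<in> topspace full_shift. \<forall>i<k. y i = x i}"
proof -
  have "openin full_shift {y \<in> topspace full_shift. y i = x i}" for i
  proof -
    have "continuous_map full_shift (discrete_topology {0, 1}) (\<lambda>s. s i)"
      unfolding full_shift_def by (rule continuous_map_product_projection) simp
    \<comment> \<open>\<open>x\<close> need not lie in the full shift, hence the intersection with
      the alphabet.\<close>
    moreover have "openin (discrete_topology {0, 1}) ({x i} \<inter> {0, 1})" by simp
    ultimately have "openin full_shift {y \<in> topspace full_shift. y i \<in> {x i} \<inter> {0, 1}}"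
      by (rule openin_continuous_map_preimage)
    moreover have "{y \<in> topspace full_shift. y i \<in> {x i} \<inter> {0, 1}} = {y \<in> topspace full_shift. y i = x i}"
      by (auto simp: topspace_full_shift)
    ultimately show ?thesis by simp
  qed
  note coord = this
  show ?thesis
  proof (induction k)
    case (Suc k)
    have "{y \<in> topspace full_shift. \<forall>i<Suc k. y i = x i} =
        {y \<in> topspace full_shift. \<forall>i<k. y i = x i} \<inter> {y \<in> topspace full_shift. y k = x k}"
      by (auto simp: less_Suc_eq)
    then show ?case using Suc coord by (simp add: openin_Int)
  qed simp
qed

text \<open>A basic open set constrains finitely many coordinates, all below some
  \<open>k\<close>.\<close>

lemma cylinder_subset_open:
  assumes "openin full_shift V" "x \<in> V"
  shows "\<exists>k. \<forall>y\<in>topspace full_shift. (\<forall>i<k. y i = x i) \<longrightarrow> y \<in> V"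
proof -
  obtain U where U: "finite {i. U i \<noteq> {0, 1}}" "x \<in> Pi\<^sub>E UNIV U" "Pi\<^sub>E UNIV U \<subseteq> V"
    using assms unfolding full_shift_def openin_product_topology_alt by force
  then obtain k where k: "\<And>i. U i \<noteq> {0, 1} \<Longrightarrow> i < k"
    by (metis (mono_tags, lifting) finite_nat_set_iff_bounded mem_Collect_eq)
  have "y \<in> V" if "y \<in> topspace full_shift" "\<forall>i<k. y i = x i" for y
  proof -
    have "y i \<in> U i" for i
    proof (cases "i < k")
      case True
      then show ?thesis using that U(2) by (auto simp: PiE_def Pi_def)
    next
      case False
      then have "U i = {0, 1}" using k by blast
      then show ?thesis using that(1) by (simp add: topspace_full_shift)
    qed
    then show ?thesis using U(3) by auto
  qed
  then show ?thesis by blast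
qed

text \<open>The Lebesgue number lemma, with agreement on the first \<open>k\<close> coordinates as
  closeness. Compactness leaves finitely many cylinders, and \<open>k\<close> bounds their
  lengths.\<close>

lemma open_cover_cylinder:
  assumes "open_cover (spacing_shift P) \<U>"
  shows "\<exists>k. \<forall>x\<in>spacing_set P. \<exists>U\<in>\<U>. \<forall>y\<in>spacing_set P. (\<forall>i<k. y i = x i) \<longrightarrow> y \<in> U"
proof -
  define Q where "Q x k U \<longleftrightarrow> U \<in> \<U> \<and> (\<forall>y\<in>spacing_set P. (\<forall>i<k. y i = x i) \<longrightarrow> y \<in> U)"
    for x :: "nat \<Rightarrow> nat" and k U
  have "\<exists>k U. Q x k U" if x: "x \<in> spacing_set P" for x
  proof -
    obtain U where U: "U \<in> \<U>" "x \<in> U"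
      using assms x unfolding open_cover_def topspace_spacing_shift by blast
    then obtain V where V: "openin full_shift V" "U = V \<inter> spacing_set P"
      using assms unfolding open_cover_def spacing_shift_def openin_subtopology by blast
    then obtain k where "\<forall>y\<in>topspace full_shift. (\<forall>i<k. y i = x i) \<longrightarrow> y \<in> V"
      using cylinder_subset_open U by blast
    then show ?thesis using U V spacing_set_subset[of P] unfolding Q_def by blast
  qed
  then obtain K U where KU: "\<And>x. x \<in> spacing_set P \<Longrightarrow> Q x (K x) (U x)"
    by metis
  define C where "C x = {y \<in> topspace full_shift. \<forall>i<K x. y i = x i}" for x
  have "spacing_set P \<subseteq> \<Union>(C ` spacing_set P)"
    using spacing_set_subset by (auto simp: C_def)
  moreover have "\<forall>V\<in>C ` spacing_set P. openin full_shift V"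
    by (auto simp: C_def openin_cylinder)
  ultimately obtain \<F> where \<F>: "finite \<F>" "\<F> \<subseteq> C ` spacing_set P" "spacing_set P \<subseteq> \<Union>\<F>"
    using compactin_spacing_set[of P] unfolding compactin_def by metis
  then obtain F where F: "finite F" "F \<subseteq> spacing_set P" "spacing_set P \<subseteq> \<Union>(C ` F)"
    by (metis finite_subset_image)
  obtain k where k: "\<And>z. z \<in> F \<Longrightarrow> K z \<le> k"
    using F(1) finite_nat_set_iff_bounded_le[of "K ` F"] by auto
  have "\<exists>U\<in>\<U>. \<forall>y\<in>spacing_set P. (\<forall>i<k. y i = x i) \<longrightarrow> y \<in> U" if x: "x \<in> spacing_set P" for x
  proof -
    obtain z where z: "z \<in> F" "x \<in> C z" using F x by blast
    then have Q: "Q z (K z) (U z)" using KU F(2) by blast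
    have "y \<in> U z" if "y \<in> spacing_set P" "\<forall>i<k. y i = x i" for y
    proof -
      have "\<forall>i<K z. y i = z i" using that(2) z k[OF z(1)] by (simp add: C_def)
      then show ?thesis using Q that(1) unfolding Q_def by blast
    qed
    then show ?thesis using Q unfolding Q_def by blast
  qed
  then show ?thesis by blast
qed

section \<open>Words and subcovers of iterated joins\<close>

text \<open>Words are represented by the sets of positions of their ones.\<close>

definition language :: "nat set \<Rightarrow> nat \<Rightarrow> nat set set" where
  "language P m = (\<lambda>x. {i. i < m \<and> x i = 1}) ` spacing_set P"

lemma language_subset: "language P m \<subseteq> Pow {..<m}"
  by (auto simp: language_def)

lemma finite_language: "finite (language P m)"
  using language_subset by (rule finite_subset) simp

lemma card_language_pos: "card (language P m) > 0"
proof -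
  have "(\<lambda>_. 0) \<in> spacing_set P"
    by (simp add: spacing_set_def topspace_full_shift)
  then show ?thesis
    by (auto simp: card_gt_0_iff finite_language) (auto simp: language_def)
qed

lemma diff_in_language: "w \<in> language P m \<Longrightarrow> diff_in P w"
proof -
  assume "w \<in> language P m"
  then obtain x where x: "x \<in> spacing_set P" "w = {i. i < m \<and> x i = 1}"
    by (auto simp: language_def)
  show ?thesis
    unfolding diff_in_def
  proof (intro ballI impI)
    fix i j assume ij: "i \<in> w" "j \<in> w" "i < j"
    then have "nat \<bar>int i - int j\<bar> \<in> P \<union> {0}"
      using x unfolding spacing_set_def by blast
    moreover have "nat \<bar>int i - int j\<bar> = j - i" using ij by linarith
    ultimately show "j - i \<in> P" using ij by auto
  qed
qed

lemma min_subcover_le: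
  assumes "\<V> \<subseteq> \<U>" "finite \<V>" "\<Union>\<V> = topspace X"
  shows "min_subcover X \<U> \<le> card \<V>"
  unfolding min_subcover_def using assms by (intro Least_le) blast

text \<open>A word of length \<open>n + k\<close> determines the first \<open>k\<close> coordinates
  of the iterates \<open>0\<close> to \<open>n - 1\<close>, hence a cover member for each of them.
  One member of the join per word suffices.\<close>

lemma min_subcover_join_le:
  assumes "open_cover (spacing_shift P) \<U>"
  shows "\<exists>k. \<forall>n. min_subcover (spacing_shift P) (iterated_join (spacing_shift P) (spacing_map P) \<U> n)
           \<le> card (language P (n + k))"
proof -
  obtain k where "\<forall>x\<in>spacing_set P. \<exists>U\<in>\<U>. \<forall>y\<in>spacing_set P. (\<forall>i<k. y i = x i) \<longrightarrow> y \<in> U"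
    using open_cover_cylinder[OF assms] by blast
  then obtain U where U: "\<And>x. x \<in> spacing_set P \<Longrightarrow> U x \<in> \<U>"
    "\<And>x y. x \<in> spacing_set P \<Longrightarrow> y \<in> spacing_set P \<Longrightarrow> \<forall>i<k. y i = x i \<Longrightarrow> y \<in> U x"
    by metis
  have "min_subcover (spacing_shift P) (iterated_join (spacing_shift P) (spacing_map P) \<U> n)
      \<le> card (language P (n + k))" for n
  proof -
    define supp where "supp x = {i. i < n + k \<and> x i = 1}" for x :: "nat \<Rightarrow> nat"
    define X where "X w = inv_into (spacing_set P) supp w" for w
    have X: "X w \<in> spacing_set P" "supp (X w) = w" if "w \<in> language P (n + k)" for w
    proof -
      have "w \<in> supp ` spacing_set P"
        using that unfolding language_def supp_def .
      then show "X w \<in> spacing_set P" "supp (X w) = w"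
        unfolding X_def by (simp_all add: inv_into_into f_inv_into_f)
    qed
    \<comment> \<open>The cover members are those attached to the shifts of the representative
      \<open>X w\<close>.\<close>
    define V where "V w = {y \<in> topspace (spacing_shift P).
        \<forall>i<n. (spacing_map P ^^ i) y \<in> U (\<lambda>j. X w (i + j))}" for w
    have "V ` language P (n + k) \<subseteq> iterated_join (spacing_shift P) (spacing_map P) \<U> n"
    proof (rule image_subsetI)
      fix w assume "w \<in> language P (n + k)"
      then have "\<forall>i<n. U (\<lambda>j. X w (i + j)) \<in> \<U>"
        using X spacing_map_funpow(2) U(1) by blast
      then show "V w \<in> iterated_join (spacing_shift P) (spacing_map P) \<U> n"
        unfolding V_def iterated_join_def
        by (intro CollectI exI[of _ "\<lambda>i. U (\<lambda>j. X w (i + j))"]) simp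
    qed
    moreover have "\<Union>(V ` language P (n + k)) = topspace (spacing_shift P)"
    proof
      show "topspace (spacing_shift P) \<subseteq> \<Union>(V ` language P (n + k))"
      proof
        fix y assume "y \<in> topspace (spacing_shift P)"
        then have y: "y \<in> spacing_set P" by (simp add: topspace_spacing_shift)
        define w where "w = supp y"
        have w: "w \<in> language P (n + k)"
          using y by (auto simp: w_def supp_def language_def)
        have *: "supp y = supp (X w)" using X(2)[OF w] by (simp add: w_def)
        have agree: "y i = X w i" if "i < n + k" for i
        proof -
          have "y i = 1 \<longleftrightarrow> X w i = 1"
            using * that unfolding supp_def by blast
          moreover have "y i = 0 \<or> y i = 1" "X w i = 0 \<or> X w i = 1"
            using y X(1)[OF w] spacing_set_subset[of P] by (auto simp: topspace_full_shift)
          ultimately show ?thesis by auto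
        qed
        have "y \<in> V w"
          unfolding V_def using y X(1)[OF w] agree
          by (auto simp: topspace_spacing_shift spacing_map_funpow intro!: U(2))
        then show "y \<in> \<Union>(V ` language P (n + k))" using w by blast
      qed
    qed (auto simp: V_def)
    ultimately have "min_subcover (spacing_shift P) (iterated_join (spacing_shift P) (spacing_map P) \<U> n)
        \<le> card (V ` language P (n + k))"
      by (intro min_subcover_le) (simp_all add: finite_language)
    also have "\<dots> \<le> card (language P (n + k))"
      by (intro card_image_le finite_language)
    finally show ?thesis .
  qed
  then show ?thesis by blast
qed

section \<open>Counting sparse words and the entropy bound\<close>

text \<open>\<open>diff_in\<close> is translation invariant, so the bound at length \<open>N\<close>
  holds on every block of that length.\<close>

lemma diff_in_card_le:
  fixes \<epsilon> :: real
  assumes N: "N > 0" "\<And>A. A \<subseteq> {..<N} \<Longrightarrow> diff_in P A \<Longrightarrow> card A \<le> \<epsilon> * N"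
    and A: "A \<subseteq> {..<m}" "diff_in P A" and "\<epsilon> \<ge> 0"
  shows "card A \<le> \<epsilon> * (m + N)"
proof -
  \<comment> \<open>Enough blocks to cover \<open>{..<m}\<close>; the overshoot is at most
    \<open>N\<close>.\<close>
  define q where "q = m div N + 1"
  have "m < q * N"
    using dividend_less_div_times[OF N(1), of m] by (simp add: q_def)
  then have "A = {..<q * N} \<inter> A" using A(1) by auto
  then have "real (card A) = (\<Sum>n<q * N. indicator A n)"
    by (simp add: indicator_def)
  also have "\<dots> = (\<Sum>i<q. \<Sum>r<N. indicator A (i * N + r))"
    by (rule sum_lessThan_mult)
  also have "\<dots> \<le> (\<Sum>i<q. \<epsilon> * N)"
  proof (rule sum_mono)
    fix i
    have "(\<Sum>r<N. indicator A (i * N + r)) = real (card ({..<N} \<inter> {r. i * N + r \<in> A}))"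
      by (simp add: indicator_def)
    also have "\<dots> \<le> \<epsilon> * N"
    proof (rule N(2))
      show "diff_in P ({..<N} \<inter> {r. i * N + r \<in> A})"
        unfolding diff_in_def
      proof (intro ballI impI)
        fix x y assume "x \<in> {..<N} \<inter> {r. i * N + r \<in> A}" "y \<in> {..<N} \<inter> {r. i * N + r \<in> A}" "x < y"
        then have "i * N + x \<in> A" "i * N + y \<in> A" "i * N + x < i * N + y" by auto
        then have "(i * N + y) - (i * N + x) \<in> P"
          using A(2) unfolding diff_in_def by blast
        then show "y - x \<in> P" by simp
      qed
    qed auto
    finally show "(\<Sum>r<N. indicator A (i * N + r)) \<le> \<epsilon> * N" .
  qed
  also have "\<dots> = \<epsilon> * (q * N)" by simp
  also have "\<dots> \<le> \<epsilon> * (real m + real N)"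
  proof -
    have "q * N \<le> m + N" by (simp add: q_def)
    then have "real (q * N) \<le> real (m + N)" by (rule of_nat_mono)
    then show ?thesis using \<open>\<epsilon> \<ge> 0\<close> by (intro mult_left_mono) auto
  qed
  finally show ?thesis .
qed

text \<open>Compares \<open>t powr R\<close> per set with the generating function \<open>(\<Sum>w\<subseteq>{..<m}. t ^ card w) = (1 + t) ^ m\<close>.\<close>

lemma ln_card_le_weighted:
  fixes \<L> :: "nat set set" and t R :: real
  assumes "\<L> \<subseteq> Pow {..<m}" "\<L> \<noteq> {}" "0 < t" "t \<le> 1" "\<And>w. w \<in> \<L> \<Longrightarrow> card w \<le> R"
  shows "ln (card \<L>) \<le> m * ln (1 + t) - R * ln t"
proof -
  have fin: "finite \<L>" using assms(1) by (rule finite_subset) simp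
  then have pos: "card \<L> > 0" using assms(2) by (simp add: card_gt_0_iff)
  have "card \<L> * t powr R = (\<Sum>w\<in>\<L>. t powr R)" by simp
  also have "\<dots> \<le> (\<Sum>w\<in>\<L>. t ^ card w)"
    using assms by (intro sum_mono) (auto simp: powr_mono' simp flip: powr_realpow)
  also have "\<dots> \<le> (\<Sum>w\<in>Pow {..<m}. t ^ card w)"
    using assms by (intro sum_mono2) auto
  also have "\<dots> = (t + 1) ^ m"
    using prod_add[of "{..<m}" "\<lambda>_. t" "\<lambda>_. 1"] by simp
  finally have "ln (card \<L> * t powr R) \<le> ln ((t + 1) ^ m)"
    using pos assms(3) by (subst ln_le_cancel_iff) auto
  then show ?thesis
    using pos assms(3) by (simp add: ln_mult ln_realpow ln_powr add.commute)
qed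

text \<open>Word counts grow at rate at most \<open>ln (1 + t) - \<epsilon> * ln t\<close>, which is
  made small by choosing first \<open>t\<close>, then \<epsilon>.\<close>

theorem spacing_entropy_eq_0:
  assumes "\<And>\<epsilon>::real. \<epsilon> > 0 \<Longrightarrow> \<exists>N>0. \<forall>A\<subseteq>{..<N}. diff_in P A \<longrightarrow> card A \<le> \<epsilon> * N"
  shows "spacing_entropy P = 0"
proof (rule antisym)
  have le_pos: "cover_entropy (spacing_shift P) (spacing_map P) \<U> \<le> ereal \<eta>"
    if \<U>: "open_cover (spacing_shift P) \<U>" and "\<eta> > 0" for \<U> \<eta>
  proof -
    define t where "t = min 1 (\<eta> / 2)"
    have t: "0 < t" "t \<le> 1" "t \<le> \<eta> / 2" using \<open>\<eta> > 0\<close> by (auto simp: t_def)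
    then have lnt: "ln t \<le> 0" by simp
    \<comment> \<open>The summand \<open>1\<close> keeps the denominator positive even when
      \<open>t = 1\<close>.\<close>
    define \<epsilon> where "\<epsilon> = \<eta> / 2 / (1 - ln t)"
    have \<epsilon>: "\<epsilon> > 0" using lnt \<open>\<eta> > 0\<close> by (simp add: \<epsilon>_def)
    obtain N where N: "N > 0" "\<forall>A\<subseteq>{..<N}. diff_in P A \<longrightarrow> card A \<le> \<epsilon> * N"
      using assms[OF \<epsilon>] by blast
    obtain k where k: "\<And>n. min_subcover (spacing_shift P)
        (iterated_join (spacing_shift P) (spacing_map P) \<U> n) \<le> card (language P (n + k))"
      using min_subcover_join_le[OF \<U>] by blast
    \<comment> \<open>\<open>C\<close> is the growth rate; \<open>D\<close> collects what does not
      depend on \<open>n\<close> and vanishes after division by \<open>n\<close>.\<close>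
    define C D where "C = ln (1 + t) - \<epsilon> * ln t" and "D = k * ln (1 + t) - \<epsilon> * (k + N) * ln t"
    have bound: "ln (min_subcover (spacing_shift P)
        (iterated_join (spacing_shift P) (spacing_map P) \<U> n)) \<le> n * C + D" for n
    proof -
      have "ln (card (language P (n + k))) \<le>
          real (n + k) * ln (1 + t) - \<epsilon> * (real (n + k) + real N) * ln t"
      proof (rule ln_card_le_weighted[OF language_subset])
        show "language P (n + k) \<noteq> {}" using card_language_pos[of P "n + k"] by auto
        show "card w \<le> \<epsilon> * (real (n + k) + real N)" if "w \<in> language P (n + k)" for w
          using diff_in_card_le[of N P \<epsilon> w "n + k"] N \<epsilon> that language_subset[of P "n + k"]
            diff_in_language[OF that] by auto
      qed (use t in auto)
      also have "\<dots> = n * C + D" by (simp add: C_def D_def algebra_simps)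
      finally have "ln (card (language P (n + k))) \<le> n * C + D" .
      \<comment> \<open>As \<open>ln 0 = 0\<close> and \<open>b\<close> is at least
        \<open>1\<close>, the case \<open>a = 0\<close> is covered.\<close>
      moreover have "ln (real a) \<le> ln (real b)" if "a \<le> b" "b > 0" for a b :: nat
        using that by (cases "a = 0") auto
      ultimately show ?thesis using k[of n] card_language_pos[of P "n + k"] by (meson order_trans)
    qed
    have "C \<le> \<eta>"
    proof -
      have "\<epsilon> * (- ln t) \<le> \<epsilon> * (1 - ln t)" using \<epsilon> by (intro mult_left_mono) auto
      also have "\<dots> = \<eta> / 2"
        using lnt \<epsilon>_def nonzero_eq_divide_eq[of "1 - ln t" \<epsilon> "\<eta> / 2"] by linarith
      finally have "- (\<epsilon> * ln t) \<le> \<eta> / 2" by simp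
      moreover have "ln (1 + t) \<le> \<eta> / 2" using ln_add_one_self_le_self[of t] t by linarith
      ultimately show ?thesis by (simp add: C_def)
    qed
    have "(\<lambda>n. C + D / real n) \<longlonglongrightarrow> C + 0"
      by (intro tendsto_intros lim_const_over_n)
    then have lim: "limsup (\<lambda>n. ereal (C + D / real n)) = ereal C"
      by (intro lim_imp_Limsup) (auto simp: tendsto_ereal)
    have "cover_entropy (spacing_shift P) (spacing_map P) \<U> \<le> limsup (\<lambda>n. ereal (C + D / real n))"
      unfolding cover_entropy_def
    proof (intro Limsup_mono eventually_sequentiallyI[of 1])
      fix n :: nat assume "n \<ge> 1"
      then show "ereal (ln (min_subcover (spacing_shift P)
        (iterated_join (spacing_shift P) (spacing_map P) \<U> n)) / n) \<le> ereal (C + D / real n)"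
        using bound[of n] by (simp add: field_simps)
    qed
    then show ?thesis
      using lim \<open>C \<le> \<eta>\<close> by (metis ereal_less_eq(3) order_trans)
  qed
  have "cover_entropy (spacing_shift P) (spacing_map P) \<U> \<le> 0"
    if "open_cover (spacing_shift P) \<U>" for \<U>
    by (rule ereal_le_epsilon2) (simp add: le_pos[OF that])
  then show "spacing_entropy P \<le> 0"
    unfolding spacing_entropy_def topological_entropy_def by (intro SUP_least) auto
  \<comment> \<open>Since entropy is a supremum over covers, the trivial cover alone gives the lower
    bound.\<close>
  have "ln (real a) / real b \<ge> 0" for a b :: nat
    by (cases "a = 0") auto
  then have "0 \<le> cover_entropy (spacing_shift P) (spacing_map P) {topspace (spacing_shift P)}"
    unfolding cover_entropy_def by (intro le_Limsup) auto
  also have "\<dots> \<le> spacing_entropy P"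
    unfolding spacing_entropy_def topological_entropy_def
    by (intro SUP_upper) (auto simp: open_cover_def)
  finally show "0 \<le> spacing_entropy P" .
qed

section \<open>The nonsquares\<close>

lemma Delta_star_set_nonsquares: "Delta_star_set nonsquares"
  unfolding Delta_star_set_def
proof (intro conjI allI impI)
  fix D assume "Delta_set D"
  then have D: "D \<subseteq> pos_nats"
    by (simp add: Delta_set_def)
  from \<open>Delta_set D\<close> obtain s where s: "strict_mono_on pos_nats s" "difference_set s \<subseteq> D"
    by (auto simp: Delta_set_def)
  show "nonsquares \<inter> D \<noteq> {}"
  proof
    assume "nonsquares \<inter> D = {}"
    then have square: "\<exists>n. s i - s j = n\<^sup>2" if "0 < j" "j < i" for i j
    proof -
      have "s i - s j \<in> difference_set s"
        unfolding difference_set_def pos_nats_def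
        by (intro CollectI exI[of _ i] exI[of _ j]) (use that in auto)
      then have "s i - s j \<in> D" "s i - s j \<in> pos_nats" using s(2) D by auto
      then have "s i - s j \<in> {n\<^sup>2 | n. n \<in> pos_nats}"
        using \<open>nonsquares \<inter> D = {}\<close> by (meson DiffI disjoint_iff)
      then show ?thesis by auto
    qed
    have less: "s j < s i" if "0 < j" "j < i" for i j
      using that strict_mono_onD[OF s(1), of j i] by (simp add: pos_nats_def)
    define a where "a = s 2 - s 1"
    have a: "s 2 = s 1 + a" "a > 0" using less[of 1 2] by (auto simp: a_def)
    have grow: "s (2 + k) \<ge> s 2 + k" for k
    proof (induction k)
      case (Suc k)
      then show ?case using less[of "2 + k" "2 + Suc k"] by simp
    qed simp
    \<comment> \<open>Large enough that \<open>s n - s 2\<close> exceeds \<open>a\<^sup>2\<close>,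
      forcing its square root \<open>y\<close> above \<open>a\<close>.\<close>
    define n where "n = 2 + (a\<^sup>2 + 1)"
    obtain x y where xy: "s n - s 1 = x\<^sup>2" "s n - s 2 = y\<^sup>2"
      using square[of 1 n] square[of 2 n] by (auto simp: n_def)
    have y: "y\<^sup>2 > a\<^sup>2" using grow[of "a\<^sup>2 + 1"] xy by (simp add: n_def)
    have "x\<^sup>2 = y\<^sup>2 + a" using xy a grow[of "a\<^sup>2 + 1"] by (simp add: n_def)
    moreover from this have "x > y" using a by (metis less_add_same_cancel1 power_less_imp_less_base zero_le)
    \<comment> \<open>Two distinct squares \<open>y\<^sup>2 < x\<^sup>2\<close> differ by at least
      \<open>2 * y + 1\<close>, but here they differ by \<open>a\<close>.\<close>
    then have "(y + 1)\<^sup>2 \<le> x\<^sup>2" by (intro power_mono) auto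
    ultimately have "y < a" by (simp add: power2_eq_square)
    then have "y\<^sup>2 \<le> a\<^sup>2" by (intro power_mono) auto
    with y show False by simp
  qed
qed auto

theorem mainTheorem4:
  fixes E P :: "nat set"
  assumes "E = {n\<^sup>2 | n. n \<in> pos_nats}"
    and "P = pos_nats - E"
  shows "Delta_star_set P \<and> spacing_entropy P = 0 \<and>
    \<not> (\<forall>Q. Q \<subseteq> pos_nats \<and> Delta_star_set Q \<longrightarrow> spacing_entropy Q > 0)"
proof -
  have P: "P = nonsquares"
    using assms by simp
  have "Delta_star_set P"
    unfolding P by (rule Delta_star_set_nonsquares)
  moreover have "spacing_entropy P = 0"
    unfolding P by (rule spacing_entropy_eq_0) (rule furstenberg_sarkozy)
  moreover have "P \<subseteq> pos_nats"
    using P by blast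
  \<comment> \<open>\<open>P\<close> itself refutes the implication in the last conjunct.\<close>
  ultimately show ?thesis
    by (metis less_irrefl)
qed

end
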